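(* Let $\Omega\subset\mathbb{R}^n$, $n\ge 2$, be a bounded domain, let $\lambda_1$ and $\lambda_2$ be real numbers, and let $a\in C(\Omega)\cap L^\infty(\Omega)$ with $a(x)>0$ in $\Omega$. Suppose that $u\in C(\overline{\Omega})$ and $v\in C(\overline{\Omega})$. (i) If $\sup_{\Omega}(u-v)>\sup_{\partial\Omega}(u-v)$, and $$\Delta_\infty u+\lambda_1 a(x)u^3\ge 0\quad\text{and}\quad\Delta_\infty v+\lambda_2 a(x)v^3\le 0\quad\text{in }\Omega,$$ then there is a point $p\in\Omega$ such that $(u-v)(p)=\sup_{\Omega}(u-v)$ and $\lambda_1u^3(p)\ge\lambda_2v^3(p)$. (ii) Similarly, if $\inf_{\Omega}(u-v)<\inf_{\partial\Omega}(u-v)$, and $$\Delta_\infty u+\lambda_1 a(x)u^3\le 0\quad\text{and}\quad\Delta_\infty v+\lambda_2 a(x)v^3\ge 0\quad\text{in }\Omega,$$ then there is a point $q\in\Omega$ such that $(u-v)(q)=\inf_{\Omega}(u-v)$ and $\lambda_1u^3(q)\le\lambda_2v^3(q)$.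
   Context: The infinity-Laplacian is $\Delta_\infty u=\sum_{i,j=1}^n \frac{\partial u}{\partial x_i}\frac{\partial u}{\partial x_j}\frac{\partial^2 u}{\partial x_i\partial x_j}$. Differential inequalities are understood in the viscosity sense: for $F\in C(\Omega\times\mathbb{R})$, a function $u\in C(\Omega)$ satisfies $\Delta_\infty u\ge F(x,u)$ in $\Omega$ if, whenever $\psi\in C^2(\Omega)$ and $u-\psi$ has a local maximum at $p\in\Omega$, one has $\Delta_\infty\psi(p)\ge F(p,u(p))$; it satisfies $\Delta_\infty u\le F(x,u)$ in $\Omega$ if, whenever $\psi\in C^2(\Omega)$ and $u-\psi$ has a local minimum at $q\in\Omega$, one has $\Delta_\infty\psi(q)\le F(q,u(q))$. The inequality $\Delta_\infty u+\lambda a(x)u^3\ge 0$ means $\Delta_\infty u\ge-\lambda a(x)u^3$, and similarly for $\le$. *)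

theory Defs
  imports "HOL-Analysis.Analysis"
begin

definition partial :: "'n::finite \<Rightarrow> (real ^ 'n \<Rightarrow> real) \<Rightarrow> real ^ 'n \<Rightarrow> real"
  where "partial i f x = deriv (\<lambda>t. f (x + t *\<^sub>R axis i 1)) 0"

definition has_partial :: "'n::finite \<Rightarrow> (real ^ 'n \<Rightarrow> real) \<Rightarrow> real ^ 'n \<Rightarrow> bool"
  where "has_partial i f x \<longleftrightarrow> (\<lambda>t. f (x + t *\<^sub>R axis i 1)) field_differentiable (at 0)"

text \<open>The class $C^2(\Omega)$, for open $\Omega$. Functions are total, but only the values
  on $\Omega$ matter.\<close>

definition C2_on :: "(real ^ 'n::finite) set \<Rightarrow> (real ^ 'n \<Rightarrow> real) \<Rightarrow> bool"
  where "C2_on \<Omega> \<psi> \<longleftrightarrow>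
    continuous_on \<Omega> \<psi> \<and>
    (\<forall>i. (\<forall>x\<in>\<Omega>. has_partial i \<psi> x) \<and> continuous_on \<Omega> (partial i \<psi>)) \<and>
    (\<forall>i j. (\<forall>x\<in>\<Omega>. has_partial i (partial j \<psi>) x) \<and>
            continuous_on \<Omega> (partial i (partial j \<psi>)))"

definition inf_laplacian :: "(real ^ 'n::finite \<Rightarrow> real) \<Rightarrow> real ^ 'n \<Rightarrow> real"
  where "inf_laplacian u x =
    (\<Sum>i\<in>UNIV. \<Sum>j\<in>UNIV. partial i u x * partial j u x * partial i (partial j u) x)"

text \<open>The inequalities $\Delta_\infty u \ge F(x,u)$ and $\Delta_\infty u \le F(x,u)$ in the open
  set $\Omega$, in the viscosity sense; they are meant for $F$ continuous on
  $\Omega \times \mathbb{R}$.\<close>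

definition visc_inf_laplacian_ge ::
    "(real ^ 'n::finite) set \<Rightarrow> (real ^ 'n \<Rightarrow> real \<Rightarrow> real) \<Rightarrow> (real ^ 'n \<Rightarrow> real) \<Rightarrow> bool"
  where "visc_inf_laplacian_ge \<Omega> F u \<longleftrightarrow>
    continuous_on \<Omega> u \<and>
    (\<forall>\<psi> p. C2_on \<Omega> \<psi> \<longrightarrow> p \<in> \<Omega> \<longrightarrow>
       (\<forall>\<^sub>F x in at p within \<Omega>. u x - \<psi> x \<le> u p - \<psi> p) \<longrightarrow>
       inf_laplacian \<psi> p \<ge> F p (u p))"

definition visc_inf_laplacian_le ::
    "(real ^ 'n::finite) set \<Rightarrow> (real ^ 'n \<Rightarrow> real \<Rightarrow> real) \<Rightarrow> (real ^ 'n \<Rightarrow> real) \<Rightarrow> bool"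
  where "visc_inf_laplacian_le \<Omega> F u \<longleftrightarrow>
    continuous_on \<Omega> u \<and>
    (\<forall>\<psi> q. C2_on \<Omega> \<psi> \<longrightarrow> q \<in> \<Omega> \<longrightarrow>
       (\<forall>\<^sub>F x in at q within \<Omega>. u x - \<psi> x \<ge> u q - \<psi> q) \<longrightarrow>
       inf_laplacian \<psi> q \<le> F q (u q))"

definition Linfty_on :: "(real ^ 'n::finite) set \<Rightarrow> (real ^ 'n \<Rightarrow> real) \<Rightarrow> bool"
  where "Linfty_on \<Omega> a \<longleftrightarrow>
    a \<in> borel_measurable (lebesgue_on \<Omega>) \<and> (\<exists>C. AE x in lebesgue_on \<Omega>. \<bar>a x\<bar> \<le> C)"

end

theory Submission
  imports Defs
begin

text \<open>
  Part (ii) is part (i) with \<open>u\<close> and \<open>v\<close> exchanged. For part (i) one has to exclude that, at every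
  maximum point \<open>p\<close> of \<open>u - v\<close>, the right-hand side of \<open>\<Delta>\<^sub>\<infinity>u \<ge> f\<close> is strictly greater than that of
  \<open>\<Delta>\<^sub>\<infinity>v \<le> g\<close>. The textbook route is to double the variables and to apply the maximum principle for
  semicontinuous functions, which rests on Jensen's lemma and Alexandrov's theorem on
  semiconvex functions. The infinity-Laplacian only sees the second derivative in the direction of
  the gradient, and this allows an elementary argument, in the spirit of the finite-difference
  proof of Jensen's uniqueness theorem by Armstrong and Smart.

  Maximise \<open>u y - v z\<close> under the hard constraint \<open>dist y z \<le> 2 * r\<close>. As \<open>r\<close> tends to \<open>0\<close>, the
  maximisers cluster at a maximum point \<open>p\<close> of \<open>u - v\<close>, which lies in \<open>\<Omega>\<close> because the supremum over
  the boundary is smaller. Let \<open>x\<^sub>0\<close> be the midpoint of \<open>y\<close> and \<open>z\<close>, put \<open>w = - v\<close>, and denote by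
  \<open>U\<close> and \<open>W\<close> the maxima of \<open>u\<close> on the sphere and of \<open>w\<close> on the closed ball of radius \<open>2 * r\<close> about \<open>x\<^sub>0\<close>.
  Points at distance at most \<open>2 * r\<close> from \<open>x\<^sub>0\<close> compete with \<open>(y, z)\<close> when paired with \<open>x\<^sub>0\<close>, so
  \[ U - u(y) \le w(z) - w(x_0), \qquad W - w(z) \le u(y) - u(x_0). \]
  Thus the outer increment of \<open>u\<close> is at most the inner increment of \<open>w\<close>, and conversely.

  Near \<open>p\<close> there is a constant \<open>c\<close> with \<open>g < c < f\<close>; after exchanging \<open>u\<close> and \<open>w\<close> it
  is positive. The one-dimensional solutions of \<open>\<phi>'\<^sup>2 \<phi>'' = c\<close> are the translates of Aronsson's
  function \<open>\<Phi> \<tau> = k * \<tau> powr (4/3)\<close>, where \<open>c = 64/81 * k ^ 3\<close>. Comparing \<open>u\<close> with \<open>\<Phi> (T + s)\<close>,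
  where \<open>s\<close> is the distance to \<open>x\<^sub>0\<close> and \<open>T\<close> is fitted to the total increment \<open>U - u(x\<^sub>0)\<close>, bounds the
  inner increment of \<open>u\<close> from above, hence the outer one from below, by those of \<open>\<Phi>\<close>
  (\<open>comparison_with_aronsson\<close>). The displayed inequalities hand these bounds over to \<open>w\<close>, and they
  force \<open>w + \<Phi> (T + 2 * r - s)\<close> to have a maximum inside the punctured ball. This contradicts
  \<open>\<Delta>\<^sub>\<infinity>w > - c\<close>, as \<open>- \<Phi> (T + 2 * r - s)\<close> solves the equation with right-hand side \<open>- c\<close>
  (\<open>no_doubled_maximum_of_profile\<close>). Since the same profile serves for \<open>u\<close> and for \<open>w\<close>, nothing is
  lost however small the gradients are. Only \<open>T \<ge> 0\<close> is delicate: it says that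
  a function with \<open>\<Delta>\<^sub>\<infinity>u > c\<close> grows from any centre at least like \<open>\<Phi>\<close>
  (\<open>sphere_growth_ge_aronsson\<close>).
\<close>

section \<open>Radial quartics as test functions\<close>

text \<open>
  Touching by a radial function of class \<open>C\<^sup>2\<close> away from its centre can be reduced to touching by a
  quadratic polynomial in the squared distance. These polynomials are smooth also at the centre
  and hence are test functions on the whole domain as they stand.
\<close>

definition radial_quartic :: "real \<Rightarrow> real \<Rightarrow> 'a::real_inner \<Rightarrow> 'a \<Rightarrow> real"
  where "radial_quartic \<beta> \<gamma> x\<^sub>0 x = \<beta> * (norm (x - x\<^sub>0))\<^sup>2 + \<gamma> * (norm (x - x\<^sub>0)) ^ 4"

lemma norm_sq_axis_shift:
  fixes x x\<^sub>0 :: "real ^ 'n::finite"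
  shows "(norm (x + t *\<^sub>R axis i 1 - x\<^sub>0))\<^sup>2 = (norm (x - x\<^sub>0))\<^sup>2 + 2 * t * (x - x\<^sub>0) $ i + t\<^sup>2"
proof -
  have *: "x + t *\<^sub>R axis i 1 - x\<^sub>0 = (x - x\<^sub>0) + t *\<^sub>R axis i 1" by simp
  show ?thesis unfolding *
    by (simp only: power2_norm_eq_inner)
       (simp add: inner_add_left inner_add_right inner_axis inner_axis' power2_eq_square algebra_simps)
qed

lemma radial_quartic_has_derivative_along_axis:
  fixes x x\<^sub>0 :: "real ^ 'n::finite"
  shows "((\<lambda>t. radial_quartic \<beta> \<gamma> x\<^sub>0 (x + t *\<^sub>R axis i 1)) has_field_derivative
     2 * (\<beta> + 2 * \<gamma> * (norm (x - x\<^sub>0))\<^sup>2) * (x - x\<^sub>0) $ i) (at 0)"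
proof -
  have n4: "n ^ 4 = (n\<^sup>2)\<^sup>2" for n :: real by simp
  show ?thesis
    unfolding radial_quartic_def n4 norm_sq_axis_shift
    by (auto intro!: derivative_eq_intros simp: algebra_simps)
qed

lemma partial_radial_quartic:
  fixes x\<^sub>0 :: "real ^ 'n::finite"
  shows "partial i (radial_quartic \<beta> \<gamma> x\<^sub>0) =
    (\<lambda>x. 2 * (\<beta> + 2 * \<gamma> * (norm (x - x\<^sub>0))\<^sup>2) * (x - x\<^sub>0) $ i)"
  unfolding partial_def using radial_quartic_has_derivative_along_axis DERIV_imp_deriv by blast

lemma partial_radial_quartic_has_derivative_along_axis:
  fixes x x\<^sub>0 :: "real ^ 'n::finite"
  shows "((\<lambda>t. partial j (radial_quartic \<beta> \<gamma> x\<^sub>0) (x + t *\<^sub>R axis i 1)) has_field_derivative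
     2 * (\<beta> + 2 * \<gamma> * (norm (x - x\<^sub>0))\<^sup>2) * (if i = j then 1 else 0)
       + 8 * \<gamma> * (x - x\<^sub>0) $ i * (x - x\<^sub>0) $ j) (at 0)"
  unfolding partial_radial_quartic norm_sq_axis_shift
  by (auto intro!: derivative_eq_intros simp: algebra_simps axis_def)

lemma partial_partial_radial_quartic:
  fixes x\<^sub>0 :: "real ^ 'n::finite"
  shows "partial i (partial j (radial_quartic \<beta> \<gamma> x\<^sub>0)) =
    (\<lambda>x. 2 * (\<beta> + 2 * \<gamma> * (norm (x - x\<^sub>0))\<^sup>2) * (if i = j then 1 else 0)
       + 8 * \<gamma> * (x - x\<^sub>0) $ i * (x - x\<^sub>0) $ j)"
  by (rule ext, subst partial_def)
     (rule DERIV_imp_deriv[OF partial_radial_quartic_has_derivative_along_axis])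

lemma C2_on_radial_quartic:
  fixes x\<^sub>0 :: "real ^ 'n::finite"
  shows "C2_on \<Omega> (radial_quartic \<beta> \<gamma> x\<^sub>0)"
proof -
  have "continuous_on \<Omega> (radial_quartic \<beta> \<gamma> x\<^sub>0)"
    unfolding radial_quartic_def[abs_def] by (intro continuous_intros)
  moreover have "has_partial i (radial_quartic \<beta> \<gamma> x\<^sub>0) x" for i x
    unfolding has_partial_def field_differentiable_def
    using radial_quartic_has_derivative_along_axis by blast
  moreover have "continuous_on \<Omega> (partial i (radial_quartic \<beta> \<gamma> x\<^sub>0))" for i
    unfolding partial_radial_quartic by (intro continuous_intros)
  moreover have "has_partial i (partial j (radial_quartic \<beta> \<gamma> x\<^sub>0)) x" for i j x
    unfolding has_partial_def field_differentiable_def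
    using partial_radial_quartic_has_derivative_along_axis by blast
  moreover have "continuous_on \<Omega> (partial i (partial j (radial_quartic \<beta> \<gamma> x\<^sub>0)))" for i j
    unfolding partial_partial_radial_quartic by (intro continuous_intros)
  ultimately show ?thesis unfolding C2_on_def by blast
qed

text \<open>
  For \<open>G t = \<beta> * t + \<gamma> * t\<^sup>2\<close> and \<open>t\<close> the squared distance to the centre, this is
  \<open>4 * t * G'\<^sup>2 * (2 * G' + 4 * t * G'')\<close>; with \<open>\<phi> s = G (s\<^sup>2)\<close> it is \<open>\<phi>'\<^sup>2 * \<phi>''\<close> at \<open>s = sqrt t\<close>.
\<close>

definition radial_quartic_inf_laplacian :: "real \<Rightarrow> real \<Rightarrow> real \<Rightarrow> real"
  where "radial_quartic_inf_laplacian \<beta> \<gamma> t = 4 * t * (\<beta> + 2 * \<gamma> * t)\<^sup>2 * (2 * \<beta> + 12 * \<gamma> * t)"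

lemma inf_laplacian_radial_quartic:
  fixes x x\<^sub>0 :: "real ^ 'n::finite"
  shows "inf_laplacian (radial_quartic \<beta> \<gamma> x\<^sub>0) x
    = radial_quartic_inf_laplacian \<beta> \<gamma> ((norm (x - x\<^sub>0))\<^sup>2)"
proof -
  define d where "d = x - x\<^sub>0"
  define N where "N = (norm d)\<^sup>2"
  define g where "g = \<beta> + 2 * \<gamma> * N"
  have N: "N = (\<Sum>i\<in>UNIV. (d $ i)\<^sup>2)"
    unfolding N_def by (simp only: power2_norm_eq_inner) (simp add: inner_vec_def power2_eq_square)
  have "inf_laplacian (radial_quartic \<beta> \<gamma> x\<^sub>0) x =
    (\<Sum>i\<in>UNIV. \<Sum>j\<in>UNIV. 2 * g * d $ i * (2 * g * d $ j) *
       (2 * g * (if i = j then 1 else 0) + 8 * \<gamma> * d $ i * d $ j))"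
    by (simp only: inf_laplacian_def partial_partial_radial_quartic)
       (simp only: partial_radial_quartic g_def N_def d_def)
  also have "\<dots> = (\<Sum>i\<in>UNIV. \<Sum>j\<in>UNIV. (if i = j then 8 * g ^ 3 * (d $ i)\<^sup>2 else 0)
        + 32 * g\<^sup>2 * \<gamma> * ((d $ i)\<^sup>2 * (d $ j)\<^sup>2))"
    by (intro sum.cong refl) (simp add: power2_eq_square power3_eq_cube algebra_simps)
  also have "\<dots> = 8 * g ^ 3 * N + 32 * g\<^sup>2 * \<gamma> * (N * N)"
    by (simp add: sum.distrib N sum_product flip: sum_distrib_left)
  also have "\<dots> = 4 * N * g\<^sup>2 * (2 * g + 8 * \<gamma> * N)"
    by (simp add: power2_eq_square power3_eq_cube algebra_simps)
  also have "2 * g + 8 * \<gamma> * N = 2 * \<beta> + 12 * \<gamma> * N" by (simp add: g_def)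
  finally show ?thesis
    by (simp add: radial_quartic_inf_laplacian_def g_def N_def d_def)
qed

text \<open>
  The part of \<open>\<Delta>\<^sub>\<infinity>u \<ge> c\<close> that the argument uses. In this form it is meaningful in any inner product
  space, and it treats \<open>u\<close> and \<open>- v\<close> alike: a supersolution \<open>v\<close> enters only through \<open>- v\<close>, because
  \<open>\<Delta>\<^sub>\<infinity>\<close> is odd.
\<close>

definition radial_sub :: "real \<Rightarrow> 'a::real_inner set \<Rightarrow> ('a \<Rightarrow> real) \<Rightarrow> bool"
  where "radial_sub c B u \<longleftrightarrow>
    (\<forall>\<beta> \<gamma> x\<^sub>0. \<forall>p\<in>B. (\<forall>\<^sub>F x in nhds p. u x - radial_quartic \<beta> \<gamma> x\<^sub>0 x \<le> u p - radial_quartic \<beta> \<gamma> x\<^sub>0 p)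
      \<longrightarrow> c \<le> radial_quartic_inf_laplacian \<beta> \<gamma> ((norm (p - x\<^sub>0))\<^sup>2))"

lemma radial_sub_subset: "radial_sub c B u \<Longrightarrow> B' \<subseteq> B \<Longrightarrow> radial_sub c B' u"
  unfolding radial_sub_def by blast

lemma eventually_nhds_imp_at_within: "eventually P (nhds x) \<Longrightarrow> eventually P (at x within S)"
  by (simp add: eventually_at_filter eventually_mono)

lemma radial_sub_of_visc_ge:
  fixes u :: "real ^ 'n::finite \<Rightarrow> real"
  assumes u: "visc_inf_laplacian_ge \<Omega> F u" and B: "B \<subseteq> \<Omega>" and c: "\<And>x. x \<in> B \<Longrightarrow> c \<le> F x (u x)"
  shows "radial_sub c B u"
  unfolding radial_sub_def
proof (intro allI ballI impI)
  fix \<beta> \<gamma> and x\<^sub>0 p :: "real ^ 'n"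
  assume p: "p \<in> B"
    and "\<forall>\<^sub>F x in nhds p. u x - radial_quartic \<beta> \<gamma> x\<^sub>0 x \<le> u p - radial_quartic \<beta> \<gamma> x\<^sub>0 p"
  then have "\<forall>\<^sub>F x in at p within \<Omega>. u x - radial_quartic \<beta> \<gamma> x\<^sub>0 x \<le> u p - radial_quartic \<beta> \<gamma> x\<^sub>0 p"
    by (intro eventually_nhds_imp_at_within)
  then have "F p (u p) \<le> inf_laplacian (radial_quartic \<beta> \<gamma> x\<^sub>0) p"
    using u B p C2_on_radial_quartic unfolding visc_inf_laplacian_ge_def by blast
  with c[OF p] show "c \<le> radial_quartic_inf_laplacian \<beta> \<gamma> ((norm (p - x\<^sub>0))\<^sup>2)"
    by (simp add: inf_laplacian_radial_quartic)
qed

lemma radial_sub_of_visc_le: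
  fixes v :: "real ^ 'n::finite \<Rightarrow> real"
  assumes v: "visc_inf_laplacian_le \<Omega> F v" and B: "B \<subseteq> \<Omega>" and c: "\<And>x. x \<in> B \<Longrightarrow> F x (v x) \<le> - c"
  shows "radial_sub c B (\<lambda>x. - v x)"
  unfolding radial_sub_def
proof (intro allI ballI impI)
  fix \<beta> \<gamma> and x\<^sub>0 p :: "real ^ 'n"
  assume p: "p \<in> B"
    and *: "\<forall>\<^sub>F x in nhds p. - v x - radial_quartic \<beta> \<gamma> x\<^sub>0 x \<le> - v p - radial_quartic \<beta> \<gamma> x\<^sub>0 p"
  have neg: "radial_quartic (-\<beta>) (-\<gamma>) x\<^sub>0 x = - radial_quartic \<beta> \<gamma> x\<^sub>0 x" for x
    by (simp add: radial_quartic_def)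
  have "\<forall>\<^sub>F x in at p within \<Omega>.
      v x - radial_quartic (-\<beta>) (-\<gamma>) x\<^sub>0 x \<ge> v p - radial_quartic (-\<beta>) (-\<gamma>) x\<^sub>0 p"
    using eventually_nhds_imp_at_within[OF *, of \<Omega>] by eventually_elim (simp add: neg)
  then have "inf_laplacian (radial_quartic (-\<beta>) (-\<gamma>) x\<^sub>0) p \<le> F p (v p)"
    using v B p C2_on_radial_quartic unfolding visc_inf_laplacian_le_def by blast
  moreover have "radial_quartic_inf_laplacian (-\<beta>) (-\<gamma>) t = - radial_quartic_inf_laplacian \<beta> \<gamma> t" for t
    by (simp add: radial_quartic_inf_laplacian_def power2_eq_square algebra_simps)
  ultimately show "c \<le> radial_quartic_inf_laplacian \<beta> \<gamma> ((norm (p - x\<^sub>0))\<^sup>2)"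
    using c[OF p] by (simp add: inf_laplacian_radial_quartic)
qed

section \<open>Radial profiles\<close>

lemma second_derivative_test_min:
  fixes h h' :: "real \<Rightarrow> real"
  assumes h: "\<forall>\<^sub>F s in nhds s\<^sub>0. (h has_real_derivative h' s) (at s)"
    and h': "(h' has_real_derivative l) (at s\<^sub>0)" "h' s\<^sub>0 = 0" "l > 0"
  shows "\<forall>\<^sub>F s in nhds s\<^sub>0. h s\<^sub>0 \<le> h s"
proof -
  obtain d1 where d1: "d1 > 0" "\<And>s. dist s s\<^sub>0 < d1 \<Longrightarrow> (h has_real_derivative h' s) (at s)"
    using h unfolding eventually_nhds_metric by blast
  obtain d2 where d2: "d2 > 0" "\<And>e. 0 < e \<Longrightarrow> e < d2 \<Longrightarrow> h' s\<^sub>0 < h' (s\<^sub>0 + e)"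
    using DERIV_pos_inc_right[OF h'(1,3)] by blast
  obtain d3 where d3: "d3 > 0" "\<And>e. 0 < e \<Longrightarrow> e < d3 \<Longrightarrow> h' (s\<^sub>0 - e) < h' s\<^sub>0"
    using DERIV_pos_inc_left[OF h'(1,3)] by blast
  define d where "d = min d1 (min d2 d3)"
  have "h s\<^sub>0 \<le> h s" if s: "dist s s\<^sub>0 < d" for s
  proof (cases s s\<^sub>0 rule: linorder_cases)
    case equal then show ?thesis by simp
  next
    case greater
    obtain z where z: "s\<^sub>0 < z" "z < s" "h s - h s\<^sub>0 = (s - s\<^sub>0) * h' z"
      using MVT2[of s\<^sub>0 s h h'] greater d1(2) s by (auto simp: d_def dist_real_def)
    then have "h' z > 0" using d2(2)[of "z - s\<^sub>0"] s h'(2) by (auto simp: d_def dist_real_def)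
    then have "(s - s\<^sub>0) * h' z \<ge> 0" using greater by simp
    with z(3) show ?thesis by linarith
  next
    case less
    obtain z where z: "s < z" "z < s\<^sub>0" "h s\<^sub>0 - h s = (s\<^sub>0 - s) * h' z"
      using MVT2[of s s\<^sub>0 h h'] less d1(2) s by (auto simp: d_def dist_real_def)
    then have "h' z < 0" using d3(2)[of "s\<^sub>0 - z"] s h'(2) by (auto simp: d_def dist_real_def)
    then have "(s\<^sub>0 - s) * h' z \<le> 0" using less by (simp add: mult_nonneg_nonpos)
    with z(3) show ?thesis by linarith
  qed
  moreover have "d > 0" using d1 d2 d3 by (simp add: d_def)
  ultimately show ?thesis unfolding eventually_nhds_metric by blast
qed

text \<open>
  Only the first two derivatives of the profile at the point of touching matter: a quadratic
  polynomial in the squared distance with the same first derivative and a second derivative larger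
  by \<open>\<eta>\<close> lies above the profile nearby, hence also touches \<open>u\<close> there, and \<open>\<eta>\<close> can be taken
  as small as desired.
\<close>

lemma radial_sub_profile:
  fixes u :: "'a::real_inner \<Rightarrow> real"
  assumes u: "radial_sub c B u" and p: "p \<in> B" "p \<noteq> x\<^sub>0"
    and max: "\<forall>\<^sub>F x in nhds p. u x - \<phi> (norm (x - x\<^sub>0)) \<le> u p - \<phi> (norm (p - x\<^sub>0))"
    and \<phi>: "\<forall>\<^sub>F s in nhds (norm (p - x\<^sub>0)). (\<phi> has_real_derivative \<phi>' s) (at s)"
    and \<phi>': "(\<phi>' has_real_derivative l) (at (norm (p - x\<^sub>0)))"
  shows "c \<le> (\<phi>' (norm (p - x\<^sub>0)))\<^sup>2 * l"
proof (rule ccontr)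
  define s\<^sub>0 where "s\<^sub>0 = norm (p - x\<^sub>0)"
  define m where "m = \<phi>' s\<^sub>0"
  have s0: "s\<^sub>0 > 0" using p by (simp add: s\<^sub>0_def)
  assume "\<not> ?thesis"
  then have less: "m\<^sup>2 * l < c" by (simp add: m_def s\<^sub>0_def)
  obtain \<eta> where \<eta>: "\<eta> > 0" and m\<eta>: "m\<^sup>2 * (l + \<eta>) < c"
  proof -
    have "((\<lambda>\<eta>. m\<^sup>2 * (l + \<eta>)) \<longlongrightarrow> m\<^sup>2 * (l + 0)) (at_right 0)" by (intro tendsto_intros)
    then have "\<forall>\<^sub>F \<eta> in at_right 0. m\<^sup>2 * (l + \<eta>) < c \<and> 0 < \<eta>"
      using less by (intro eventually_conj order_tendstoD(2) eventually_at_right_less) auto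
    then show ?thesis using that eventually_happens[of _ "at_right (0::real)"] by auto
  qed
  \<comment> \<open>The coefficients match the first derivative of \<open>\<phi>\<close> at \<open>s\<^sub>0\<close> and exceed the second by \<open>\<eta>\<close>.\<close>
  define \<gamma> where "\<gamma> = (l + \<eta> - m / s\<^sub>0) / (8 * s\<^sub>0\<^sup>2)"
  define \<beta> where "\<beta> = m / (2 * s\<^sub>0) - 2 * \<gamma> * s\<^sub>0\<^sup>2"
  define h where "h = (\<lambda>s. \<beta> * s\<^sup>2 + \<gamma> * s ^ 4 - \<phi> s)"
  have e1: "\<beta> + 2 * \<gamma> * s\<^sub>0\<^sup>2 = m / (2 * s\<^sub>0)" by (simp add: \<beta>_def)
  have e2: "8 * s\<^sub>0\<^sup>2 * \<gamma> = l + \<eta> - m / s\<^sub>0" using s0 by (simp add: \<gamma>_def)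
  have "\<forall>\<^sub>F s in nhds s\<^sub>0. h s\<^sub>0 \<le> h s"
  proof (rule second_derivative_test_min)
    show "\<forall>\<^sub>F s in nhds s\<^sub>0. (h has_real_derivative 2 * \<beta> * s + 4 * \<gamma> * s ^ 3 - \<phi>' s) (at s)"
      using \<phi> unfolding s\<^sub>0_def[symmetric]
      by eventually_elim (auto simp: h_def intro!: derivative_eq_intros)
    show "((\<lambda>s. 2 * \<beta> * s + 4 * \<gamma> * s ^ 3 - \<phi>' s) has_real_derivative
        2 * \<beta> + 12 * \<gamma> * s\<^sub>0\<^sup>2 - l) (at s\<^sub>0)"
      using \<phi>' unfolding s\<^sub>0_def[symmetric]
      by (auto intro!: derivative_eq_intros)
    have "2 * \<beta> * s\<^sub>0 + 4 * \<gamma> * s\<^sub>0 ^ 3 = 2 * s\<^sub>0 * (\<beta> + 2 * \<gamma> * s\<^sub>0\<^sup>2)"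
      by (simp add: power2_eq_square power3_eq_cube algebra_simps)
    also have "\<dots> = m" unfolding e1 using s0 by simp
    finally show "2 * \<beta> * s\<^sub>0 + 4 * \<gamma> * s\<^sub>0 ^ 3 - \<phi>' s\<^sub>0 = 0" by (simp add: m_def)
    have "2 * \<beta> + 12 * \<gamma> * s\<^sub>0\<^sup>2 - l = 2 * (\<beta> + 2 * \<gamma> * s\<^sub>0\<^sup>2) + 8 * s\<^sub>0\<^sup>2 * \<gamma> - l" by simp
    also have "\<dots> = \<eta>" unfolding e1 e2 by simp
    finally show "0 < 2 * \<beta> + 12 * \<gamma> * s\<^sub>0\<^sup>2 - l" using \<eta> by simp
  qed
  moreover have "filterlim (\<lambda>x. norm (x - x\<^sub>0)) (nhds s\<^sub>0) (nhds p)"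
    unfolding s\<^sub>0_def by (intro tendsto_intros filterlim_ident)
  ultimately have "\<forall>\<^sub>F x in nhds p. h s\<^sub>0 \<le> h (norm (x - x\<^sub>0))"
    by (rule eventually_compose_filterlim)
  with max have "\<forall>\<^sub>F x in nhds p. u x - radial_quartic \<beta> \<gamma> x\<^sub>0 x \<le> u p - radial_quartic \<beta> \<gamma> x\<^sub>0 p"
    by eventually_elim (simp add: h_def radial_quartic_def s\<^sub>0_def)
  with u p have "c \<le> radial_quartic_inf_laplacian \<beta> \<gamma> (s\<^sub>0\<^sup>2)"
    unfolding radial_sub_def s\<^sub>0_def by blast
  also have "\<dots> = 4 * s\<^sub>0\<^sup>2 * (m / (2 * s\<^sub>0))\<^sup>2 * (2 * (m / (2 * s\<^sub>0)) + 8 * s\<^sub>0\<^sup>2 * \<gamma>)"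
    unfolding radial_quartic_inf_laplacian_def e1[symmetric] by (simp add: algebra_simps)
  also have "\<dots> = m\<^sup>2 * (l + \<eta>)" unfolding e2 using s0 by (simp add: power2_eq_square field_simps)
  finally show False using m\<eta> by simp
qed

section \<open>The profile of Aronsson's function\<close>

text \<open>
  The plane function \<open>\<bar>x\<bar> powr (4/3) - \<bar>y\<bar> powr (4/3)\<close> is Aronsson's infinity-harmonic function.
  Its first summand, as a function of \<open>x > 0\<close>, satisfies \<open>\<phi>'\<^sup>2 \<phi>'' = 64/81\<close>.
\<close>

definition aronsson :: "real \<Rightarrow> real \<Rightarrow> real"
  where "aronsson k \<tau> = k * \<tau> powr (4/3)"

lemma aronsson_has_derivatives:
  assumes "\<tau> > 0"
  shows "(aronsson k has_real_derivative 4/3 * k * \<tau> powr (1/3)) (at \<tau>)"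
    and "((\<lambda>\<tau>. 4/3 * k * \<tau> powr (1/3)) has_real_derivative 4/9 * k * \<tau> powr (-2/3)) (at \<tau>)"
  unfolding aronsson_def[abs_def] using assms
  by (auto intro!: derivative_eq_intros)

lemma aronsson_equation:
  fixes k \<tau> :: real
  assumes "\<tau> > 0"
  shows "(4/3 * k * \<tau> powr (1/3))\<^sup>2 * (4/9 * k * \<tau> powr (-2/3)) = 64/81 * k ^ 3"
proof -
  have "(\<tau> powr (1/3))\<^sup>2 * \<tau> powr (-2/3) = 1"
    using assms by (simp add: power2_eq_square flip: powr_add)
  then show ?thesis
    by (simp add: power_mult_distrib power2_eq_square power3_eq_cube algebra_simps)
qed

lemma aronsson_mono: "k \<ge> 0 \<Longrightarrow> 0 \<le> s \<Longrightarrow> s \<le> t \<Longrightarrow> aronsson k s \<le> aronsson k t"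
  unfolding aronsson_def by (intro mult_left_mono powr_mono2) auto

lemma aronsson_strict_mono: "k > 0 \<Longrightarrow> 0 \<le> s \<Longrightarrow> s < t \<Longrightarrow> aronsson k s < aronsson k t"
  unfolding aronsson_def by (intro mult_strict_left_mono powr_less_mono2) auto

lemma continuous_on_aronsson [continuous_intros]:
  assumes "continuous_on A f" "\<And>x. x \<in> A \<Longrightarrow> f x \<ge> 0"
  shows "continuous_on A (\<lambda>x. aronsson k (f x))"
  unfolding aronsson_def using assms
  by (intro continuous_intros continuous_on_powr') auto

text \<open>
  Read contrapositively, this and the next lemma are the comparison principle: if the constant of
  \<open>u\<close> beats the constant of the profile, their difference has no local maximum off the centre. The
  two orientations of the profile have constants of opposite sign, and they serve for the two
  functions that are compared.
\<close>

lemma radial_sub_aronsson_outward: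
  fixes u :: "'a::real_inner \<Rightarrow> real"
  assumes u: "radial_sub c B u" and p: "p \<in> B" "p \<noteq> x\<^sub>0" and T: "T + norm (p - x\<^sub>0) > 0"
    and max: "\<forall>\<^sub>F x in nhds p. u x - aronsson k (T + norm (x - x\<^sub>0))
      \<le> u p - aronsson k (T + norm (p - x\<^sub>0))"
  shows "c \<le> 64/81 * k ^ 3"
proof -
  have "c \<le> (4/3 * k * (T + norm (p - x\<^sub>0)) powr (1/3))\<^sup>2 * (4/9 * k * (T + norm (p - x\<^sub>0)) powr (-2/3))"
  proof (rule radial_sub_profile[OF u p max])
    have "\<forall>\<^sub>F s in nhds (norm (p - x\<^sub>0)). s \<in> {-T<..}"
      using T by (intro eventually_nhds_in_open) auto
    then show "\<forall>\<^sub>F s in nhds (norm (p - x\<^sub>0)). ((\<lambda>s. aronsson k (T + s))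
        has_real_derivative 4/3 * k * (T + s) powr (1/3)) (at s)"
      by eventually_elim
         (auto intro!: derivative_eq_intros DERIV_chain2[OF aronsson_has_derivatives(1), THEN DERIV_cong])
    show "((\<lambda>s. 4/3 * k * (T + s) powr (1/3)) has_real_derivative
        4/9 * k * (T + norm (p - x\<^sub>0)) powr (-2/3)) (at (norm (p - x\<^sub>0)))"
      using T by (auto intro!: derivative_eq_intros)
  qed
  then show ?thesis unfolding aronsson_equation[OF T] .
qed

lemma radial_sub_aronsson_inward:
  fixes u :: "'a::real_inner \<Rightarrow> real"
  assumes u: "radial_sub c B u" and p: "p \<in> B" "p \<noteq> x\<^sub>0" and T: "T - norm (p - x\<^sub>0) > 0"
    and max: "\<forall>\<^sub>F x in nhds p. u x + aronsson k (T - norm (x - x\<^sub>0))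
      \<le> u p + aronsson k (T - norm (p - x\<^sub>0))"
  shows "c \<le> - (64/81 * k ^ 3)"
proof -
  have max': "\<forall>\<^sub>F x in nhds p. u x - (- aronsson k (T - norm (x - x\<^sub>0)))
      \<le> u p - (- aronsson k (T - norm (p - x\<^sub>0)))" using max by simp
  have "c \<le> (4/3 * k * (T - norm (p - x\<^sub>0)) powr (1/3))\<^sup>2 * (- (4/9 * k * (T - norm (p - x\<^sub>0)) powr (-2/3)))"
  proof (rule radial_sub_profile[OF u p max'])
    have "\<forall>\<^sub>F s in nhds (norm (p - x\<^sub>0)). s \<in> {..<T}"
      using T by (intro eventually_nhds_in_open) auto
    then show "\<forall>\<^sub>F s in nhds (norm (p - x\<^sub>0)). ((\<lambda>s. - aronsson k (T - s))
        has_real_derivative 4/3 * k * (T - s) powr (1/3)) (at s)"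
      by eventually_elim
         (auto intro!: derivative_eq_intros DERIV_chain2[OF aronsson_has_derivatives(1)])
    show "((\<lambda>s. 4/3 * k * (T - s) powr (1/3)) has_real_derivative
        - (4/9 * k * (T - norm (p - x\<^sub>0)) powr (-2/3))) (at (norm (p - x\<^sub>0)))"
      using T by (auto intro!: derivative_eq_intros)
  qed
  then show ?thesis using aronsson_equation[OF T, of k] by (simp only: mult_minus_right)
qed

section \<open>Comparison on a ball\<close>

text \<open>
  The centre is treated as a part of the boundary, where the two sides agree; hence the kink of the
  radial profile at the centre does no harm.
\<close>

lemma comparison_with_aronsson:
  fixes u :: "'a::euclidean_space \<Rightarrow> real"
  assumes u: "radial_sub c (ball x\<^sub>0 R) u" "continuous_on (cball x\<^sub>0 R) u"
    and k: "64/81 * k ^ 3 < c" and T: "T \<ge> 0" and R: "R > 0"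
    and bd: "\<And>x. dist x\<^sub>0 x = R \<Longrightarrow> u x \<le> u x\<^sub>0 + aronsson k (T + R) - aronsson k T"
    and y: "y \<in> cball x\<^sub>0 R"
  shows "u y \<le> u x\<^sub>0 + aronsson k (T + dist x\<^sub>0 y) - aronsson k T"
proof -
  define m where "m = (\<lambda>x. u x - aronsson k (T + norm (x - x\<^sub>0)))"
  have dn: "dist x\<^sub>0 x = norm (x - x\<^sub>0)" for x by (simp add: dist_norm norm_minus_commute)
  have "continuous_on (cball x\<^sub>0 R) m"
    unfolding m_def using T by (intro continuous_intros u) auto
  then obtain p where p: "p \<in> cball x\<^sub>0 R" and pmax: "\<And>x. x \<in> cball x\<^sub>0 R \<Longrightarrow> m x \<le> m p"
    using continuous_attains_sup[of "cball x\<^sub>0 R" m] R by auto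
  have "m p \<le> m x\<^sub>0"
  proof (cases "p = x\<^sub>0 \<or> dist x\<^sub>0 p = R")
    case True
    then show ?thesis using bd[of p] by (auto simp: m_def dn)
  next
    case False
    then have p': "p \<in> ball x\<^sub>0 R" "p \<noteq> x\<^sub>0" using p by auto
    have "\<forall>\<^sub>F x in nhds p. x \<in> ball x\<^sub>0 R" using p' by (intro eventually_nhds_in_open) auto
    then have "\<forall>\<^sub>F x in nhds p. m x \<le> m p"
      by eventually_elim (rule pmax, simp)
    then have "c \<le> 64/81 * k ^ 3"
      unfolding m_def using T p' by (intro radial_sub_aronsson_outward[OF u(1) p']) (auto simp: add_nonneg_pos)
    then show ?thesis using k by simp
  qed
  with pmax[OF y] show ?thesis by (simp add: m_def dn)
qed

text \<open>
  The parabola osculates the shifted profile at \<open>s = 3 * \<mu>\<close>: value, first and second derivative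
  agree, and the difference changes sign there. With \<open>s = \<mu> * (z ^ 3 + 2)\<close> the fractional powers
  disappear and the difference is a polynomial with the triple zero \<open>z = 1\<close>. The minimum of the two
  functions is thus a barrier that follows the parabola near the centre and the profile further
  out; the parabola repairs the failure of \<open>s powr (4/3)\<close> to be twice differentiable at \<open>0\<close>.
\<close>

lemma quadratic_below_shifted_aronsson:
  assumes k: "k > 0" and \<mu>: "\<mu> > 0" and s: "s \<ge> 2 * \<mu>"
  defines "q \<equiv> 2/9 * k * \<mu> powr (-2/3) * s\<^sup>2"
    and "\<phi> \<equiv> aronsson k (s - 2 * \<mu>) + aronsson k \<mu>"
  shows "s \<le> 3 * \<mu> \<Longrightarrow> q \<le> \<phi>" "s \<ge> 3 * \<mu> \<Longrightarrow> \<phi> \<le> q"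
proof -
  define z where "z = ((s - 2 * \<mu>) / \<mu>) powr (1/3)"
  have z0: "z \<ge> 0" by (simp add: z_def)
  have z3: "z ^ 3 = (s - 2 * \<mu>) / \<mu>"
  proof (cases "s = 2 * \<mu>")
    case False
    then show ?thesis using s \<mu> unfolding z_def by (subst powr_power) auto
  qed (simp add: z_def)
  then have s_eq: "s = \<mu> * (z ^ 3 + 2)" using \<mu> by (simp add: field_simps)
  have z4: "(s - 2 * \<mu>) powr (4/3) = \<mu> powr (4/3) * z ^ 4"
  proof -
    have "s - 2 * \<mu> = \<mu> * z ^ 3" unfolding s_eq by (simp add: algebra_simps)
    moreover have "(z ^ 3) powr (4/3) = z ^ 4"
    proof (cases "z = 0")
      case False
      then have "z > 0" using z0 by simp
      then have "(z ^ 3) powr (4/3) = (z powr 3) powr (4/3)" by (simp add: powr_numeral)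
      also have "\<dots> = z powr 4" by (simp only: powr_powr) simp
      finally show ?thesis using \<open>z > 0\<close> by (simp add: powr_numeral)
    qed simp
    ultimately show ?thesis using \<mu> z0 by (simp only: powr_mult zero_le_power less_imp_le)
  qed
  have \<mu>2: "\<mu> powr (-2/3) * \<mu>\<^sup>2 = \<mu> powr (4/3)"
  proof -
    have "\<mu>\<^sup>2 = \<mu> powr 2" using \<mu> by (simp add: powr_numeral)
    then show ?thesis by (simp only: powr_add[symmetric]) simp
  qed
  have "q = 2/9 * k * (\<mu> powr (-2/3) * \<mu>\<^sup>2) * (z ^ 3 + 2)\<^sup>2"
    unfolding q_def s_eq by (simp add: power_mult_distrib)
  then have "q - \<phi> = k * \<mu> powr (4/3) * (2/9 * (z ^ 3 + 2)\<^sup>2 - z ^ 4 - 1)"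
    unfolding \<mu>2 \<phi>_def aronsson_def z4 by (simp add: algebra_simps)
  also have "2/9 * (z ^ 3 + 2)\<^sup>2 - z ^ 4 - 1 = (2 * (z ^ 3 + 2)\<^sup>2 - 9 * z ^ 4 - 9) / 9"
    by simp
  also have "2 * (z ^ 3 + 2)\<^sup>2 - 9 * z ^ 4 - 9 = (2 * z ^ 3 + 6 * z\<^sup>2 + 3 * z + 1) * (z - 1) ^ 3"
    by algebra
  finally have diff: "q - \<phi> = (k * \<mu> powr (4/3) * ((2 * z ^ 3 + 6 * z\<^sup>2 + 3 * z + 1) / 9)) * (z - 1) ^ 3"
    by (simp only: times_divide_eq_left times_divide_eq_right mult.assoc)
  have pos: "k * \<mu> powr (4/3) * ((2 * z ^ 3 + 6 * z\<^sup>2 + 3 * z + 1) / 9) \<ge> 0"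
    using k z0 by (intro mult_nonneg_nonneg) auto
  have z1: "z ^ 3 \<le> 1 \<Longrightarrow> z \<le> 1" "z ^ 3 \<ge> 1 \<Longrightarrow> z \<ge> 1"
    using z0 power_le_one_iff[of z 3] one_le_power[of z 3] power_mono_iff[of 1 z 3] by auto
  show "q \<le> \<phi>" if "s \<le> 3 * \<mu>"
  proof -
    have "z \<le> 1" using that \<mu> by (intro z1) (simp add: z3 field_simps)
    then have "(z - 1) ^ 3 \<le> 0" by (simp add: power_le_zero_eq)
    then have "q - \<phi> \<le> 0" unfolding diff using pos by (rule mult_nonneg_nonpos[rotated])
    then show ?thesis by simp
  qed
  show "\<phi> \<le> q" if "s \<ge> 3 * \<mu>"
  proof -
    have "z \<ge> 1" using that \<mu> by (intro z1) (simp add: z3 field_simps)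
    then have "(z - 1) ^ 3 \<ge> 0" by simp
    then have "q - \<phi> \<ge> 0" unfolding diff using pos by simp
    then show ?thesis by simp
  qed
qed

text \<open>
  The profile itself cannot be used as a barrier here, since its point of contact could be the
  centre, where it is not \<open>C\<^sup>2\<close>. It is replaced by the minimum of a parabola and a shifted profile,
  which converges to it as \<open>\<mu>\<close> tends to \<open>0\<close>. A minimum of barriers is again a barrier: at a point of
  contact, the smaller of the two touches \<open>u\<close> from above.
\<close>

lemma sphere_growth_ge_aronsson:
  fixes u :: "'a::euclidean_space \<Rightarrow> real"
  assumes u: "radial_sub c (ball x\<^sub>0 R) u" "continuous_on (cball x\<^sub>0 R) u"
    and k: "k > 0" "64/81 * k ^ 3 < c" and R: "R > 0"
  shows "\<exists>x. dist x\<^sub>0 x = R \<and> u x\<^sub>0 + aronsson k R \<le> u x"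
proof (rule ccontr)
  assume neg: "\<not> ?thesis"
  have dn: "dist x\<^sub>0 x = norm (x - x\<^sub>0)" for x by (simp add: dist_norm norm_minus_commute)
  have "continuous_on (sphere x\<^sub>0 R) u"
    using u(2) sphere_cball continuous_on_subset by blast
  then obtain x1 where x1: "dist x\<^sub>0 x1 = R" and x1max: "\<And>x. dist x\<^sub>0 x = R \<Longrightarrow> u x \<le> u x1"
    using continuous_attains_sup[of "sphere x\<^sub>0 R" u] R by auto
  have lt: "u x1 - u x\<^sub>0 < aronsson k R" using neg x1 by force
  obtain \<mu> where \<mu>: "\<mu> > 0" "3 * \<mu> < R" and \<mu>lt: "u x1 - u x\<^sub>0 < aronsson k (R - 2 * \<mu>) + aronsson k \<mu>"
  proof -
    have "continuous_on {0..R/4} (\<lambda>\<mu>. aronsson k (R - 2 * \<mu>) + aronsson k \<mu>)"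
      using R by (intro continuous_intros) auto
    then have "((\<lambda>\<mu>. aronsson k (R - 2 * \<mu>) + aronsson k \<mu>) \<longlongrightarrow> aronsson k (R - 2 * 0) + aronsson k 0)
        (at 0 within {0..R/4})"
      using R unfolding continuous_on_def by (elim ballE[of _ _ 0]) auto
    then have "((\<lambda>\<mu>. aronsson k (R - 2 * \<mu>) + aronsson k \<mu>) \<longlongrightarrow> aronsson k R) (at_right 0)"
      using R by (simp add: at_within_Icc_at_right aronsson_def)
    then have "\<forall>\<^sub>F \<mu> in at_right 0. u x1 - u x\<^sub>0 < aronsson k (R - 2 * \<mu>) + aronsson k \<mu>"
      using lt by (rule order_tendstoD(1))
    moreover have "\<forall>\<^sub>F \<mu> in at_right 0. \<mu> \<in> {0<..<R/3}"
      using R by (intro eventually_at_right_real) auto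
    ultimately have "\<forall>\<^sub>F \<mu> in at_right 0. u x1 - u x\<^sub>0 < aronsson k (R - 2 * \<mu>) + aronsson k \<mu> \<and> \<mu> \<in> {0<..<R/3}"
      by (rule eventually_conj)
    then obtain \<mu> where "u x1 - u x\<^sub>0 < aronsson k (R - 2 * \<mu>) + aronsson k \<mu>" "\<mu> \<in> {0<..<R/3}"
      using eventually_happens[of _ "at_right (0::real)"] by auto
    then show ?thesis by (intro that[of \<mu>]) auto
  qed
  \<comment> \<open>The truncation by \<open>max 0\<close> keeps \<open>\<phi>\<close> continuous below \<open>2 * \<mu>\<close>, where the minimum is \<open>q\<close> anyway.\<close>
  define a where "a = 2/9 * k * \<mu> powr (-2/3)"
  define q where "q = (\<lambda>s. a * s\<^sup>2)"
  define \<phi> where "\<phi> = (\<lambda>s. aronsson k (max 0 (s - 2 * \<mu>)) + aronsson k \<mu>)"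
  have a0: "a > 0" using k \<mu> by (simp add: a_def)
  have q\<phi>: "q s \<le> \<phi> s" if "0 \<le> s" "s \<le> 3 * \<mu>" for s
  proof (cases "s \<ge> 2 * \<mu>")
    case True
    then show ?thesis
      using quadratic_below_shifted_aronsson(1)[OF k(1) \<mu>(1) True that(2)]
      by (simp add: q_def \<phi>_def a_def)
  next
    case False
    have "q s \<le> q (2 * \<mu>)" unfolding q_def using a0 that False by (intro mult_left_mono power_mono) auto
    also have "\<dots> \<le> \<phi> s"
      using quadratic_below_shifted_aronsson(1)[OF k(1) \<mu>(1), of "2 * \<mu>"] False \<mu>
      by (simp add: q_def \<phi>_def a_def)
    finally show ?thesis .
  qed
  have \<phi>q: "\<phi> s \<le> q s" if "s \<ge> 3 * \<mu>" for s
    using quadratic_below_shifted_aronsson(2)[OF k(1) \<mu>(1) _ that] that \<mu>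
    by (simp add: q_def \<phi>_def a_def)
  define m where "m = (\<lambda>x. u x - min (q (norm (x - x\<^sub>0))) (\<phi> (norm (x - x\<^sub>0))))"
  have "continuous_on (cball x\<^sub>0 R) m"
    unfolding m_def q_def \<phi>_def by (intro continuous_intros u) auto
  then obtain p where p: "p \<in> cball x\<^sub>0 R" and pmax: "\<And>x. x \<in> cball x\<^sub>0 R \<Longrightarrow> m x \<le> m p"
    using continuous_attains_sup[of "cball x\<^sub>0 R" m] R by auto
  have "m x\<^sub>0 = u x\<^sub>0" using q\<phi>[of 0] \<mu> by (simp add: m_def q_def)
  with pmax[of x\<^sub>0] R have mp: "u x\<^sub>0 \<le> m p" by simp
  have "dist x\<^sub>0 p \<noteq> R"
  proof
    assume pR: "dist x\<^sub>0 p = R"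
    then have "m p = u p - \<phi> R" using \<phi>q[of R] \<mu> by (simp add: m_def dn)
    moreover have "\<phi> R = aronsson k (R - 2 * \<mu>) + aronsson k \<mu>" using \<mu> by (simp add: \<phi>_def)
    ultimately show False using mp \<mu>lt x1max[OF pR] by simp
  qed
  with p have p': "p \<in> ball x\<^sub>0 R" by auto
  then have "\<forall>\<^sub>F x in nhds p. x \<in> ball x\<^sub>0 R" by (intro eventually_nhds_in_open) auto
  then have nhd: "\<forall>\<^sub>F x in nhds p. m x \<le> m p"
    by eventually_elim (rule pmax, simp)
  have "c \<le> 64/81 * k ^ 3"
  proof (cases "norm (p - x\<^sub>0) \<le> 3 * \<mu>")
    case True
    then have mpq: "m p = u p - q (norm (p - x\<^sub>0))" using q\<phi> by (simp add: m_def)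
    have um: "u x - q (norm (x - x\<^sub>0)) \<le> m x" for x by (simp add: m_def)
    have rq: "radial_quartic a 0 x\<^sub>0 x = q (norm (x - x\<^sub>0))" for x
      by (simp add: radial_quartic_def q_def)
    have "\<forall>\<^sub>F x in nhds p. u x - radial_quartic a 0 x\<^sub>0 x \<le> u p - radial_quartic a 0 x\<^sub>0 p"
      unfolding rq mpq[symmetric] using nhd by eventually_elim (rule order_trans[OF um])
    then have "c \<le> radial_quartic_inf_laplacian a 0 ((norm (p - x\<^sub>0))\<^sup>2)"
      using u(1) p' unfolding radial_sub_def by blast
    also have "\<dots> = 8 * a ^ 3 * (norm (p - x\<^sub>0))\<^sup>2"
      by (simp add: radial_quartic_inf_laplacian_def power2_eq_square power3_eq_cube)
    \<comment> \<open>The infinity-Laplacian of the parabola grows with the distance; at the switching radius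
      it reaches the constant of the profile.\<close>
    also have "\<dots> \<le> 8 * a ^ 3 * (3 * \<mu>)\<^sup>2"
      using a0 True by (intro mult_left_mono power_mono) auto
    also have "\<dots> = 64/81 * k ^ 3 * ((\<mu> powr (-2/3)) ^ 3 * \<mu>\<^sup>2)"
      by (simp add: a_def power_mult_distrib power2_eq_square power3_eq_cube)
    also have "(\<mu> powr (-2/3)) ^ 3 * \<mu>\<^sup>2 = 1"
    proof -
      have "(\<mu> powr (-2/3)) ^ 3 = (\<mu> powr (-2/3)) powr 3" using \<mu> by (simp add: powr_numeral)
      also have "\<dots> = \<mu> powr (-2)" by (simp only: powr_powr) simp
      finally have "(\<mu> powr (-2/3)) ^ 3 * \<mu>\<^sup>2 = \<mu> powr (-2) * \<mu> powr 2" using \<mu> by (simp add: powr_numeral)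
      also have "\<dots> = \<mu> powr 0" by (simp only: powr_add[symmetric]) simp
      finally show ?thesis using \<mu> by simp
    qed
    finally show ?thesis by simp
  next
    case False
    then have mp\<phi>: "m p = u p - \<phi> (norm (p - x\<^sub>0))" using \<phi>q by (simp add: m_def)
    have "\<forall>\<^sub>F x in nhds p. x \<in> - cball x\<^sub>0 (2 * \<mu>)"
      using False \<mu> by (intro eventually_nhds_in_open) (auto simp: dn)
    with nhd have "\<forall>\<^sub>F x in nhds p. u x - aronsson k (- 2 * \<mu> + norm (x - x\<^sub>0))
       \<le> u p - aronsson k (- 2 * \<mu> + norm (p - x\<^sub>0))"
    proof eventually_elim
      case (elim x)
      have "u x - \<phi> (norm (x - x\<^sub>0)) \<le> m x" by (simp add: m_def)
      then have "u x - \<phi> (norm (x - x\<^sub>0)) \<le> u p - \<phi> (norm (p - x\<^sub>0))" using elim(1) mp\<phi> by linarith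
      then show ?case using elim(2) False \<mu> by (simp add: \<phi>_def dn)
    qed
    moreover have "p \<noteq> x\<^sub>0" "- 2 * \<mu> + norm (p - x\<^sub>0) > 0" using False \<mu> by auto
    ultimately show ?thesis by (intro radial_sub_aronsson_outward[OF u(1) p'])
  qed
  with k show False by simp
qed

text \<open>
  The increment over a fixed length is continuous in \<open>T\<close>, and it is unbounded because the derivative
  of the profile is.
\<close>

lemma aronsson_increment_attains:
  assumes k: "k > 0" and R: "R > 0" and D: "aronsson k R \<le> D"
  shows "\<exists>T\<ge>0. aronsson k (T + R) - aronsson k T = D"
proof -
  define g where "g = (\<lambda>T. aronsson k (T + R) - aronsson k T)"
  have D0: "D > 0" using D aronsson_strict_mono[OF k, of 0 R] R by (simp add: aronsson_def)
  \<comment> \<open>At \<open>b\<close> the slope of the profile is at least \<open>D / R\<close>, so that the increment exceeds \<open>D\<close>.\<close>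
  define d where "d = D / (k * R)"
  define b where "b = d ^ 3"
  have d0: "d > 0" using D0 k R by (simp add: d_def)
  then have b: "b > 0" by (simp add: b_def)
  obtain \<xi> where \<xi>: "b < \<xi>" "aronsson k (b + R) - aronsson k b = (b + R - b) * (4/3 * k * \<xi> powr (1/3))"
    using MVT2[of b "b + R" "aronsson k" "\<lambda>\<tau>. 4/3 * k * \<tau> powr (1/3)"] R b
      aronsson_has_derivatives(1) by (metis add.commute less_add_same_cancel2 less_le_trans)
  have "d = b powr (1/3)"
  proof -
    have "b = d powr 3" using d0 by (simp add: b_def powr_numeral)
    then have "b powr (1/3) = d powr (3 * (1/3))" by (simp only: powr_powr)
    then show ?thesis using d0 by simp
  qed
  also have "\<dots> \<le> \<xi> powr (1/3)" using \<xi> b by (intro powr_mono2) auto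
  finally have "k * R * d \<le> k * R * \<xi> powr (1/3)" using k R by simp
  moreover have "k * R * d = D" using k R by (simp add: d_def)
  moreover have "g b = 4/3 * (k * R * \<xi> powr (1/3))" using \<xi>(2) by (simp add: g_def)
  ultimately have "D \<le> g b" using D0 by linarith
  moreover have "g 0 \<le> D" using D by (simp add: g_def aronsson_def)
  moreover have "continuous_on {0..b} g" unfolding g_def using R by (intro continuous_intros) auto
  ultimately obtain T where "0 \<le> T" "g T = D" using IVT'[of g 0 D b] b by auto
  then show ?thesis unfolding g_def by blast
qed

text \<open>
  The crucial comparison, for a positive constant \<open>64/81 * k ^ 3\<close> that separates the two equations.
  The profile fitted to \<open>u\<close> controls both increments of \<open>u\<close>, hence those of \<open>w\<close>, and the reflected
  profile then touches \<open>w\<close> from above at an admissible point.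
\<close>

lemma no_doubled_maximum_of_profile:
  fixes u w :: "'a::euclidean_space \<Rightarrow> real"
  assumes u: "radial_sub c1 (ball x\<^sub>0 (2 * r)) u" "continuous_on (cball x\<^sub>0 (2 * r)) u"
    and w: "radial_sub c2 (ball x\<^sub>0 (2 * r)) w" "continuous_on (cball x\<^sub>0 (2 * r)) w"
    and k: "k > 0" "64/81 * k ^ 3 < c1" "- (64/81 * k ^ 3) < c2"
    and r: "r > 0" and yz: "y \<in> cball x\<^sub>0 r" "z \<in> cball x\<^sub>0 r"
    and Hu: "\<And>x. x \<in> cball x\<^sub>0 (2 * r) \<Longrightarrow> u x + w x\<^sub>0 \<le> u y + w z"
    and Hw: "\<And>x. x \<in> cball x\<^sub>0 (2 * r) \<Longrightarrow> u x\<^sub>0 + w x \<le> u y + w z"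
  shows False
proof -
  have dn: "dist x\<^sub>0 x = norm (x - x\<^sub>0)" for x by (simp add: dist_norm norm_minus_commute)
  have "continuous_on (sphere x\<^sub>0 (2 * r)) u"
    using u(2) sphere_cball continuous_on_subset by blast
  then obtain x1 where x1: "dist x\<^sub>0 x1 = 2 * r" and x1max: "\<And>x. dist x\<^sub>0 x = 2 * r \<Longrightarrow> u x \<le> u x1"
    using continuous_attains_sup[of "sphere x\<^sub>0 (2 * r)" u] r by auto
  have "aronsson k (2 * r) \<le> u x1 - u x\<^sub>0"
    using sphere_growth_ge_aronsson[OF u k(1,2)] r x1max by force
  then obtain T where T: "T \<ge> 0" and Teq: "aronsson k (T + 2 * r) - aronsson k T = u x1 - u x\<^sub>0"
    using aronsson_increment_attains[OF k(1), of "2 * r"] r by auto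
  have "u y \<le> u x\<^sub>0 + aronsson k (T + dist x\<^sub>0 y) - aronsson k T"
  proof (rule comparison_with_aronsson[OF u k(2) T])
    show "u x \<le> u x\<^sub>0 + aronsson k (T + 2 * r) - aronsson k T" if "dist x\<^sub>0 x = 2 * r" for x
      using x1max[OF that] Teq by linarith
  qed (use r yz in auto)
  moreover have "aronsson k (T + dist x\<^sub>0 y) \<le> aronsson k (T + r)"
    using k T yz by (intro aronsson_mono) auto
  ultimately have uy: "u y - u x\<^sub>0 \<le> aronsson k (T + r) - aronsson k T" by linarith
  have wz: "aronsson k (T + 2 * r) - aronsson k (T + r) \<le> w z - w x\<^sub>0"
    using Hu[of x1] x1 uy Teq by simp
  have "aronsson k (T + r) < aronsson k (T + 2 * r)"
    using k T r by (intro aronsson_strict_mono) auto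
  with wz have zx0: "z \<noteq> x\<^sub>0" by auto
  have wmax: "w x \<le> w z + aronsson k (T + r) - aronsson k T" if "x \<in> cball x\<^sub>0 (2 * r)" for x
    using Hw[OF that] uy by linarith
  \<comment> \<open>At \<open>z\<close> the function \<open>m\<close> is at least as large as at the centre and on the bounding sphere; so
    either its maximum is interior and off the centre, or \<open>z\<close> is such a maximum point as well.\<close>
  define m where "m = (\<lambda>x. w x + aronsson k (T + 2 * r - norm (x - x\<^sub>0)))"
  have "continuous_on (cball x\<^sub>0 (2 * r)) m"
    unfolding m_def using T by (intro continuous_intros w) (auto simp: dn)
  then obtain p where p: "p \<in> cball x\<^sub>0 (2 * r)" and pmax: "\<And>x. x \<in> cball x\<^sub>0 (2 * r) \<Longrightarrow> m x \<le> m p"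
    using continuous_attains_sup[of "cball x\<^sub>0 (2 * r)" m] r by auto
  have "aronsson k (T + r) \<le> aronsson k (T + 2 * r - norm (z - x\<^sub>0))"
    using k T yz r by (intro aronsson_mono) (auto simp: dn)
  then have mz: "w z + aronsson k (T + r) \<le> m z" by (simp add: m_def)
  have "\<exists>p. p \<in> ball x\<^sub>0 (2 * r) \<and> p \<noteq> x\<^sub>0 \<and> (\<forall>x\<in>cball x\<^sub>0 (2 * r). m x \<le> m p)"
  proof (cases "p = x\<^sub>0 \<or> dist x\<^sub>0 p = 2 * r")
    case True
    then have "m p \<le> w z + aronsson k (T + r)"
    proof
      assume "p = x\<^sub>0"
      then show ?thesis using wz by (simp add: m_def)
    next
      assume "dist x\<^sub>0 p = 2 * r"
      then show ?thesis using wmax[OF p] by (simp add: m_def dn)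
    qed
    with mz have "m p \<le> m z" by simp
    then have "\<forall>x\<in>cball x\<^sub>0 (2 * r). m x \<le> m z" using pmax order_trans by blast
    moreover have "z \<in> ball x\<^sub>0 (2 * r)" using yz r by auto
    ultimately show ?thesis using zx0 by blast
  next
    case False
    then show ?thesis using p pmax by (intro exI[of _ p]) auto
  qed
  then obtain p where p: "p \<in> ball x\<^sub>0 (2 * r)" "p \<noteq> x\<^sub>0"
    and pm: "\<And>x. x \<in> cball x\<^sub>0 (2 * r) \<Longrightarrow> m x \<le> m p" by blast
  have "\<forall>\<^sub>F x in nhds p. x \<in> ball x\<^sub>0 (2 * r)" using p by (intro eventually_nhds_in_open) auto
  then have "\<forall>\<^sub>F x in nhds p. m x \<le> m p"
    by eventually_elim (rule pm, simp)
  then have "c2 \<le> - (64/81 * k ^ 3)"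
    unfolding m_def using T p by (intro radial_sub_aronsson_inward[OF w(1) p]) (auto simp: dn)
  with k show False by simp
qed

text \<open>
  The separating constant may be chosen nonzero. If it is negative, exchanging \<open>u\<close> and \<open>w\<close> makes it
  positive, as the hypotheses are symmetric.
\<close>

lemma no_doubled_maximum:
  fixes u w :: "'a::euclidean_space \<Rightarrow> real"
  assumes u: "radial_sub c1 (ball x\<^sub>0 (2 * r)) u" "continuous_on (cball x\<^sub>0 (2 * r)) u"
    and w: "radial_sub c2 (ball x\<^sub>0 (2 * r)) w" "continuous_on (cball x\<^sub>0 (2 * r)) w"
    and c: "c1 + c2 > 0"
    and r: "r > 0" and yz: "y \<in> cball x\<^sub>0 r" "z \<in> cball x\<^sub>0 r"
    and Hu: "\<And>x. x \<in> cball x\<^sub>0 (2 * r) \<Longrightarrow> u x + w x\<^sub>0 \<le> u y + w z"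
    and Hw: "\<And>x. x \<in> cball x\<^sub>0 (2 * r) \<Longrightarrow> u x\<^sub>0 + w x \<le> u y + w z"
  shows False
proof -
  have ex: "\<exists>k>0. 64/81 * k ^ 3 = c" if "c > 0" for c :: real
    using that by (intro exI[of _ "root 3 (81/64 * c)"]) auto
  obtain c where c': "- c2 < c" "c < c1" "c \<noteq> 0"
  proof (cases "c1 > 0")
    case True
    with c dense[of "max 0 (- c2)" c1] show ?thesis by (auto intro!: that)
  next
    case False
    with c dense[of "- c2" c1] show ?thesis by (force intro!: that)
  qed
  show False
  proof (cases "c > 0")
    case True
    with ex[of c] obtain k where "k > 0" "64/81 * k ^ 3 = c" by blast
    with c' show False
      by (intro no_doubled_maximum_of_profile[OF u w _ _ _ r yz Hu Hw, of k]) auto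
  next
    case False
    with c' ex[of "-c"] obtain k where k: "k > 0" "64/81 * k ^ 3 = - c" by auto
    show False
      by (rule no_doubled_maximum_of_profile[OF w u _ _ _ r yz(2,1), of k])
         (use c' k Hu Hw in \<open>auto simp: add.commute\<close>)
  qed
qed

section \<open>Doubling the variables\<close>

text \<open>
  The right-hand sides enter only through their continuous values along \<open>u\<close> and \<open>v\<close>: a strict
  inequality between them at a maximum point \<open>p\<close> persists with constants near \<open>p\<close>, where the maximisers
  of the doubled problem are found for small \<open>r\<close>.
\<close>

lemma exists_argmax_with_source_inequality:
  fixes \<Omega> :: "(real ^ 'n::finite) set" and u v :: "real ^ 'n \<Rightarrow> real"
  assumes \<Omega>: "open \<Omega>" "\<Omega> \<noteq> {}" "bounded \<Omega>"
    and u: "continuous_on (closure \<Omega>) u" "visc_inf_laplacian_ge \<Omega> F u"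
    and v: "continuous_on (closure \<Omega>) v" "visc_inf_laplacian_le \<Omega> G v"
    and F: "continuous_on \<Omega> (\<lambda>x. F x (u x))" and G: "continuous_on \<Omega> (\<lambda>x. G x (v x))"
    and sup: "(SUP x\<in>frontier \<Omega>. u x - v x) < (SUP x\<in>\<Omega>. u x - v x)"
  shows "\<exists>p\<in>\<Omega>. u p - v p = (SUP x\<in>\<Omega>. u x - v x) \<and> F p (u p) \<le> G p (v p)"
proof (rule ccontr)
  define M where "M = (SUP x\<in>\<Omega>. u x - v x)"
  assume "\<not> ?thesis"
  then have strict: "\<And>p. p \<in> \<Omega> \<Longrightarrow> u p - v p = M \<Longrightarrow> G p (v p) < F p (u p)"
    unfolding M_def by force
  define S where "S = closure \<Omega>"
  have S: "compact S" "\<Omega> \<subseteq> S" "S \<noteq> {}"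
    unfolding S_def using \<Omega> compact_closure closure_subset[of \<Omega>] by auto
  have "compact ((\<lambda>x. u x - v x) ` S)"
    using S u v unfolding S_def by (intro compact_continuous_image continuous_intros) auto
  then have bdd: "bdd_above ((\<lambda>x. u x - v x) ` S)"
    by (intro bounded_imp_bdd_above compact_imp_bounded)
  have le_sup: "u x - v x \<le> (SUP x\<in>A. u x - v x)" if "x \<in> A" "A \<subseteq> S" for x A
    by (rule cSUP_upper[OF that(1) bdd_above_mono[OF bdd image_mono[OF that(2)]]])
  define \<rho> where "\<rho> = (\<lambda>n. 1 / real (Suc n))"
  have \<rho>: "\<rho> n > 0" for n by (simp add: \<rho>_def)
  have \<rho>0: "\<rho> \<longlonglongrightarrow> 0" unfolding \<rho>_def by (rule LIMSEQ_Suc[OF lim_1_over_n])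
  define K where "K = (\<lambda>n. (S \<times> S) \<inter> {yz. dist (fst yz) (snd yz) \<le> 2 * \<rho> n})"
  have "\<exists>yz\<in>K n. \<forall>yz'\<in>K n. u (fst yz') - v (snd yz') \<le> u (fst yz) - v (snd yz)" for n
  proof (rule continuous_attains_sup)
    show "compact (K n)" unfolding K_def
      by (intro compact_Int_closed compact_Times S closed_Collect_le continuous_intros)
    obtain s where "s \<in> S" using S by auto
    then have "(s, s) \<in> K n" using \<rho>[of n] by (simp add: K_def)
    then show "K n \<noteq> {}" by blast
    show "continuous_on (K n) (\<lambda>yz. u (fst yz) - v (snd yz))"
      by (intro continuous_on_diff continuous_on_compose2[OF u(1)] continuous_on_compose2[OF v(1)]
            continuous_on_fst continuous_on_snd continuous_on_id) (auto simp: K_def S_def)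
  qed
  then obtain Q where Q: "\<And>n. Q n \<in> K n"
    and Qmax: "\<And>n yz. yz \<in> K n \<Longrightarrow> u (fst yz) - v (snd yz) \<le> u (fst (Q n)) - v (snd (Q n))"
    by metis
  have "\<forall>n. Q n \<in> S \<times> S" using Q by (auto simp: K_def)
  then obtain pp \<sigma> where pp: "pp \<in> S \<times> S" and \<sigma>: "strict_mono (\<sigma> :: nat \<Rightarrow> nat)"
    and lim: "(Q \<circ> \<sigma>) \<longlonglongrightarrow> pp"
    using compact_Times[OF S(1) S(1)] unfolding compact_def by blast
  define p where "p = fst pp"
  have Y: "(\<lambda>n. fst (Q (\<sigma> n))) \<longlonglongrightarrow> p" and Z': "(\<lambda>n. snd (Q (\<sigma> n))) \<longlonglongrightarrow> snd pp"
    using tendsto_fst[OF lim] tendsto_snd[OF lim] by (simp_all add: p_def)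
  have \<rho>\<sigma>: "(\<lambda>n. \<rho> (\<sigma> n)) \<longlonglongrightarrow> 0"
    using LIMSEQ_subseq_LIMSEQ[OF \<rho>0 \<sigma>] by (simp add: comp_def)
  have "snd pp = p"
  proof -
    have "dist (fst (Q (\<sigma> n))) (snd (Q (\<sigma> n))) \<le> 2 * \<rho> (\<sigma> n)" for n
      using Q[of "\<sigma> n"] by (simp add: K_def)
    then have "dist p (snd pp) \<le> 2 * 0"
      by (intro LIMSEQ_le[OF tendsto_dist[OF Y Z'] tendsto_mult[OF tendsto_const \<rho>\<sigma>]]) auto
    then show ?thesis by simp
  qed
  then have Z: "(\<lambda>n. snd (Q (\<sigma> n))) \<longlonglongrightarrow> p" using Z' by simp
  have pS: "p \<in> S" using pp by (auto simp: p_def)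
  have QS: "fst (Q n) \<in> S" "snd (Q n) \<in> S" for n using Q[of n] by (auto simp: K_def)
  have "M \<le> u (fst (Q n)) - v (snd (Q n))" for n
    unfolding M_def
  proof (rule cSUP_least[OF \<Omega>(2)])
    fix x assume "x \<in> \<Omega>"
    then have "(x, x) \<in> K n" using S \<rho>[of n] by (auto simp: K_def)
    from Qmax[OF this] show "u x - v x \<le> u (fst (Q n)) - v (snd (Q n))" by simp
  qed
  moreover have "(\<lambda>n. u (fst (Q (\<sigma> n))) - v (snd (Q (\<sigma> n)))) \<longlonglongrightarrow> u p - v p"
    using u v Y Z pS QS unfolding S_def
    by (intro tendsto_diff continuous_on_tendsto_compose[of "closure \<Omega>" u]
         continuous_on_tendsto_compose[of "closure \<Omega>" v]) auto
  ultimately have Mp: "M \<le> u p - v p" by (intro LIMSEQ_le_const) auto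
  have p\<Omega>: "p \<in> \<Omega>"
  proof (rule ccontr)
    assume "p \<notin> \<Omega>"
    then have "p \<in> frontier \<Omega>" using pS \<Omega> by (simp add: frontier_def S_def interior_open)
    then have "u p - v p \<le> (SUP x\<in>frontier \<Omega>. u x - v x)"
      by (intro le_sup) (auto simp: frontier_def S_def)
    with Mp sup show False by (simp add: M_def)
  qed
  then have "u p - v p = M" using Mp le_sup[of p \<Omega>] S by (simp add: M_def)
  with strict p\<Omega> have gap: "G p (v p) < F p (u p)" by blast
  \<comment> \<open>\<open>c1\<close> and \<open>- c2\<close> divide the interval from \<open>G p (v p)\<close> to \<open>F p (u p)\<close> into three equal parts.\<close>
  define c1 where "c1 = (2 * F p (u p) + G p (v p)) / 3"
  define c2 where "c2 = - (F p (u p) + 2 * G p (v p)) / 3"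
  have c: "c1 + c2 > 0" using gap by (simp add: c1_def c2_def field_simps)
  have cont: "(h \<longlongrightarrow> h p) (nhds p)" if "continuous_on \<Omega> h" for h :: "real ^ 'n \<Rightarrow> real"
    using that \<Omega>(1) p\<Omega>
    by (simp add: continuous_on_eq_continuous_at isCont_def flip: tendsto_at_iff_tendsto_nhds)
  have "c1 < F p (u p)" "G p (v p) < - c2" using gap by (simp_all add: c1_def c2_def field_simps)
  then have "\<forall>\<^sub>F x in nhds p. c1 < F x (u x)" "\<forall>\<^sub>F x in nhds p. G x (v x) < - c2"
    by (simp_all only: order_tendstoD(1)[OF cont[OF F]] order_tendstoD(2)[OF cont[OF G]])
  moreover have "\<forall>\<^sub>F x in nhds p. x \<in> \<Omega>" using \<Omega> p\<Omega> by (intro eventually_nhds_in_open)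
  ultimately have "\<forall>\<^sub>F x in nhds p. c1 < F x (u x) \<and> G x (v x) < - c2 \<and> x \<in> \<Omega>"
    by eventually_elim blast
  then obtain d where d: "d > 0"
    and near: "\<And>x. x \<in> ball p d \<Longrightarrow> c1 < F x (u x) \<and> G x (v x) < - c2 \<and> x \<in> \<Omega>"
    unfolding eventually_nhds_metric by (auto simp: dist_commute)
  have sub_u: "radial_sub c1 (ball p d) u"
    using near by (intro radial_sub_of_visc_ge[OF u(2)]) (auto simp: less_imp_le subset_iff)
  have sub_v: "radial_sub c2 (ball p d) (\<lambda>x. - v x)"
    using near by (intro radial_sub_of_visc_le[OF v(2)]) (auto simp: less_imp_le subset_iff)
  have "\<forall>\<^sub>F n in sequentially. dist (fst (Q (\<sigma> n))) p < d/4 \<and> dist (snd (Q (\<sigma> n))) p < d/4 \<and> \<rho> (\<sigma> n) < d/8"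
    using d by (intro eventually_conj tendstoD[OF Y] tendstoD[OF Z] order_tendstoD(2)[OF \<rho>\<sigma>]) auto
  then obtain n where n: "dist (fst (Q (\<sigma> n))) p < d/4" "dist (snd (Q (\<sigma> n))) p < d/4" "\<rho> (\<sigma> n) < d/8"
    using eventually_happens[of _ sequentially] by auto
  define y z r where "y = fst (Q (\<sigma> n))" and "z = snd (Q (\<sigma> n))" and "r = \<rho> (\<sigma> n)"
  define x\<^sub>0 where "x\<^sub>0 = midpoint y z"
  have r: "r > 0" using \<rho> by (simp add: r_def)
  have yz: "dist y z \<le> 2 * r" using Q[of "\<sigma> n"] by (simp add: K_def y_def z_def r_def)
  then have x0: "dist x\<^sub>0 y \<le> r" "dist x\<^sub>0 z \<le> r" by (simp_all add: x\<^sub>0_def dist_midpoint)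
  have "dist p x\<^sub>0 < d/2"
    using dist_triangle[of p x\<^sub>0 y] x0(1) n d by (simp add: dist_commute y_def r_def)
  then have sub: "cball x\<^sub>0 (2 * r) \<subseteq> ball p d"
  proof (intro subsetI)
    fix x assume "dist p x\<^sub>0 < d/2" "x \<in> cball x\<^sub>0 (2 * r)"
    then show "x \<in> ball p d" using dist_triangle[of p x x\<^sub>0] n(3) d by (simp add: r_def)
  qed
  have sub\<Omega>: "cball x\<^sub>0 (2 * r) \<subseteq> S" 
  proof (rule order_trans[OF sub])
    have "ball p d \<subseteq> \<Omega>" by (rule subsetI, drule near, elim conjE)
    then show "ball p d \<subseteq> S" using S(2) by (rule order_trans)
  qed
  have opt: "u x - v x' \<le> u y - v z" if "x \<in> S" "x' \<in> S" "dist x x' \<le> 2 * r" for x x'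
    using Qmax[of "(x, x')" "\<sigma> n"] that by (simp add: K_def y_def z_def r_def)
  have x0S: "x\<^sub>0 \<in> S" using sub\<Omega> r by auto
  show False
  proof (rule no_doubled_maximum[of c1 x\<^sub>0 r u c2 "\<lambda>x. - v x" y z])
    show "radial_sub c1 (ball x\<^sub>0 (2 * r)) u" "radial_sub c2 (ball x\<^sub>0 (2 * r)) (\<lambda>x. - v x)"
      using radial_sub_subset[OF sub_u] radial_sub_subset[OF sub_v]
        order_trans[OF ball_subset_cball sub] by simp_all
    show "continuous_on (cball x\<^sub>0 (2 * r)) u" "continuous_on (cball x\<^sub>0 (2 * r)) (\<lambda>x. - v x)"
      using continuous_on_subset[OF u(1)] continuous_on_subset[OF v(1)] sub\<Omega>
      unfolding S_def by (simp_all add: continuous_on_minus)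
    show "y \<in> cball x\<^sub>0 r" "z \<in> cball x\<^sub>0 r" using x0 by simp_all
    fix x assume x: "x \<in> cball x\<^sub>0 (2 * r)"
    then have xS: "x \<in> S" using sub\<Omega> by (rule subsetD[rotated])
    show "u x + - v x\<^sub>0 \<le> u y + - v z" using opt[OF xS x0S] x by (simp add: dist_commute)
    show "u x\<^sub>0 + - v x \<le> u y + - v z" using opt[OF x0S xS] x by simp
  qed (rule c r)+
qed

theorem lemma2p2:
  fixes \<Omega> :: "(real ^ 'n::finite) set"
    and a u v :: "real ^ 'n \<Rightarrow> real"
    and lam1 lam2 :: real
  assumes "CARD('n) \<ge> 2"
    and "open \<Omega>" "connected \<Omega>" "\<Omega> \<noteq> {}" "bounded \<Omega>"
    and "continuous_on \<Omega> a" "Linfty_on \<Omega> a" "\<forall>x\<in>\<Omega>. a x > 0"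
    and "continuous_on (closure \<Omega>) u" "continuous_on (closure \<Omega>) v"
  shows "((SUP x\<in>\<Omega>. u x - v x) > (SUP x\<in>frontier \<Omega>. u x - v x) \<and>
          visc_inf_laplacian_ge \<Omega> (\<lambda>x t. - lam1 * a x * t ^ 3) u \<and>
          visc_inf_laplacian_le \<Omega> (\<lambda>x t. - lam2 * a x * t ^ 3) v \<longrightarrow>
          (\<exists>p\<in>\<Omega>. u p - v p = (SUP x\<in>\<Omega>. u x - v x) \<and> lam1 * u p ^ 3 \<ge> lam2 * v p ^ 3)) \<and>
         ((INF x\<in>\<Omega>. u x - v x) < (INF x\<in>frontier \<Omega>. u x - v x) \<and>
          visc_inf_laplacian_le \<Omega> (\<lambda>x t. - lam1 * a x * t ^ 3) u \<and>
          visc_inf_laplacian_ge \<Omega> (\<lambda>x t. - lam2 * a x * t ^ 3) v \<longrightarrow>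
          (\<exists>q\<in>\<Omega>. u q - v q = (INF x\<in>\<Omega>. u x - v x) \<and> lam1 * u q ^ 3 \<le> lam2 * v q ^ 3))"
proof -
  have argmax: "\<exists>p\<in>\<Omega>. f p - g p = (SUP x\<in>\<Omega>. f x - g x) \<and> l2 * g p ^ 3 \<le> l1 * f p ^ 3"
    if fg: "continuous_on (closure \<Omega>) f" "continuous_on (closure \<Omega>) g"
      and visc: "visc_inf_laplacian_ge \<Omega> (\<lambda>x t. - l1 * a x * t ^ 3) f"
        "visc_inf_laplacian_le \<Omega> (\<lambda>x t. - l2 * a x * t ^ 3) g"
      and sup: "(SUP x\<in>frontier \<Omega>. f x - g x) < (SUP x\<in>\<Omega>. f x - g x)"
    for f g l1 l2
  proof -
    have "continuous_on \<Omega> f" "continuous_on \<Omega> g"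
      using fg closure_subset by (auto intro: continuous_on_subset)
    then have "continuous_on \<Omega> (\<lambda>x. - l1 * a x * f x ^ 3)" "continuous_on \<Omega> (\<lambda>x. - l2 * a x * g x ^ 3)"
      using assms(6) by (auto intro!: continuous_intros)
    from exists_argmax_with_source_inequality[OF assms(2,4,5) fg(1) visc(1) fg(2) visc(2) this sup]
    obtain p where p: "p \<in> \<Omega>" "f p - g p = (SUP x\<in>\<Omega>. f x - g x)"
      and "- l1 * a p * f p ^ 3 \<le> - l2 * a p * g p ^ 3" by blast
    then have "a p * (l2 * g p ^ 3) \<le> a p * (l1 * f p ^ 3)" by (simp add: mult_ac)
    moreover have "a p > 0" using assms(8) p(1) by (rule bspec)
    ultimately show ?thesis using p by (intro bexI[of _ p]) (simp_all add: mult_le_cancel_left_pos)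
  qed
  have neg: "(INF x\<in>A. u x - v x) = - (SUP x\<in>A. v x - u x)" for A
    by (simp add: Inf_real_def image_image)
  have "\<exists>q\<in>\<Omega>. u q - v q = (INF x\<in>\<Omega>. u x - v x) \<and> lam1 * u q ^ 3 \<le> lam2 * v q ^ 3"
    if inf: "(INF x\<in>\<Omega>. u x - v x) < (INF x\<in>frontier \<Omega>. u x - v x)"
      and visc: "visc_inf_laplacian_le \<Omega> (\<lambda>x t. - lam1 * a x * t ^ 3) u"
      "visc_inf_laplacian_ge \<Omega> (\<lambda>x t. - lam2 * a x * t ^ 3) v"
  proof -
    obtain q where "q \<in> \<Omega>" "v q - u q = (SUP x\<in>\<Omega>. v x - u x)" "lam1 * u q ^ 3 \<le> lam2 * v q ^ 3"
      using argmax[OF assms(10,9) visc(2,1)] inf unfolding neg by auto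
    then show ?thesis unfolding neg by (intro bexI[of _ q]) auto
  qed
  then show ?thesis using argmax[OF assms(9,10)] by blast
qed

end
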